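(* Let $G$ be a finite nilpotent group which is not cyclic, and let $r,s$ be real numbers. Then $T_G(r,s)>0$ if $r>s$, $T_G(r,s)=0$ if $r=s$, and $T_G(r,s)<0$ if $r<s$.
   Context: $o(x)$ is the order of $x$, $\varphi$ is Euler's totient function, and $C_N$ is the cyclic group of order $N$. For a finite group $G$ and reals $r,s$, $R_G(r,s) := \sum_{x\in G} \frac{o(x)^s}{\varphi(o(x))^r}$ and $T_G(r,s) := R_G(r,s) - R_{C_{|G|}}(r,s)$. *)

theory Defs
  imports Complex_Main "HOL-Algebra.Algebra" "HOL-Number_Theory.Number_Theory"
begin

text \<open>Lower central series: gamma_1 = G (index 0 here), gamma_{i+1} = [gamma_i, G].\<close>
fun lower_central :: "('a, 'b) monoid_scheme \<Rightarrow> nat \<Rightarrow> 'a set" where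
  "lower_central G 0 = carrier G"
| "lower_central G (Suc n) =
     generate G (\<Union>h \<in> lower_central G n. \<Union>g \<in> carrier G.
        {h \<otimes>\<^bsub>G\<^esub> g \<otimes>\<^bsub>G\<^esub> inv\<^bsub>G\<^esub> h \<otimes>\<^bsub>G\<^esub> inv\<^bsub>G\<^esub> g})"

definition nilpotent_group :: "('a, 'b) monoid_scheme \<Rightarrow> bool" where
  "nilpotent_group G \<longleftrightarrow> group G \<and> (\<exists>n. lower_central G n = {\<one>\<^bsub>G\<^esub>})"

definition R_fun :: "('a, 'b) monoid_scheme \<Rightarrow> real \<Rightarrow> real \<Rightarrow> real" where
  "R_fun G r s = (\<Sum>x \<in> carrier G.
      real (group.ord G x) powr s / real (totient (group.ord G x)) powr r)"

definition T_fun :: "('a, 'b) monoid_scheme \<Rightarrow> real \<Rightarrow> real \<Rightarrow> real" where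
  "T_fun G r s = R_fun G r s - R_fun (integer_mod_group (order G)) r s"

end

(*
  In a nilpotent group elements of coprime order commute. Choosing one Sylow p-subgroup for each
  prime p dividing the order, the products of one element from each of them are therefore pairwise
  distinct, so they exhaust the group, and their orders multiply. As d^s / phi(d)^r is multiplicative
  in d, R_G is the product over p of the same sum taken over the Sylow p-subgroup; this applies to
  the cyclic group as well. For a p-group, R is compared with its cyclic counterpart by summation by
  parts: at least p^k elements have order dividing p^k (there is a subgroup of order p^k), in the
  cyclic case exactly p^k, and for k >= 1 the summand at p^(k+1) is p^(s-r) times that at p^k. The
  comparison is strict at a prime whose Sylow subgroup has no element of full order, and such a
  prime exists since otherwise the product of generators would generate G.
*)
theory Submission
  imports Defs
begin

hide_const (open) Divisibility.prime

section \<open>Elements of coprime order in a nilpotent group\<close>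

context group
begin

lemma mult_inv_cancel:
  assumes "x \<in> carrier G" "y \<in> carrier G"
  shows "x \<otimes> (inv x \<otimes> y) = y" "inv x \<otimes> (x \<otimes> y) = y"
  using assms by (simp_all flip: m_assoc)

text \<open>Here \<open>z\<close> is the commutator of \<open>x\<close> and \<open>y\<close>. Moving
  \<open>y\<close> past \<open>x [^] m\<close> produces \<open>z [^] m\<close>, and moving
  \<open>x\<close> past \<open>y [^] n\<close> produces \<open>z [^] n\<close>; both are therefore
  trivial, and \<open>m\<close>, \<open>n\<close> are coprime. Exponents stand in for orders because
  orders may shrink in a quotient.\<close>

lemma central_commutator_eq_one:
  fixes m n :: nat
  assumes carr: "x \<in> carrier G" "y \<in> carrier G" "z \<in> carrier G"
    and xy: "x \<otimes> y = z \<otimes> y \<otimes> x"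
    and zx: "z \<otimes> x = x \<otimes> z" and zy: "z \<otimes> y = y \<otimes> z"
    and ord: "x [^] m = \<one>" "y [^] n = \<one>" "coprime m n"
  shows "z = \<one>"
proof -
  have zxk: "x [^] k \<otimes> z = z \<otimes> x [^] k" for k :: nat
    using carr zx by (simp add: group_commutes_pow)
  have zyk: "y [^] k \<otimes> z = z \<otimes> y [^] k" for k :: nat
    using carr zy by (simp add: group_commutes_pow)
  have 1: "x [^] k \<otimes> y = z [^] k \<otimes> y \<otimes> x [^] k" for k :: nat
  proof (induction k)
    case (Suc k)
    have "x [^] Suc k \<otimes> y = x [^] k \<otimes> (z \<otimes> y \<otimes> x)"
      using carr by (simp add: m_assoc xy)
    also have "\<dots> = z \<otimes> (x [^] k \<otimes> y) \<otimes> x"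
      using carr by (simp flip: m_assoc add: zxk)
    also have "\<dots> = z [^] Suc k \<otimes> y \<otimes> x [^] Suc k"
      unfolding Suc.IH nat_pow_Suc2[OF carr(3)] using carr by (simp add: m_assoc)
    finally show ?case .
  qed (use carr in simp)
  have 2: "x \<otimes> y [^] k = z [^] k \<otimes> y [^] k \<otimes> x" for k :: nat
  proof (induction k)
    case (Suc k)
    have "x \<otimes> y [^] Suc k = z [^] k \<otimes> y [^] k \<otimes> x \<otimes> y"
      using carr by (simp flip: m_assoc add: Suc.IH)
    also have "\<dots> = z [^] k \<otimes> (y [^] k \<otimes> z) \<otimes> y \<otimes> x"
      using carr by (simp add: m_assoc xy)
    also have "\<dots> = z [^] Suc k \<otimes> y [^] Suc k \<otimes> x"
      unfolding zyk using carr by (simp add: m_assoc)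
    finally show ?case .
  qed (use carr in simp)
  have "z [^] m = \<one>" using 1[of m] carr ord(1) by simp
  moreover have "z [^] n = \<one>" using 2[of n] carr ord(2) by simp
  ultimately have "ord z dvd 1"
    using carr(3) ord(3) by (metis pow_eq_id coprime_common_divisor_nat dvd_refl)
  then show ?thesis using carr(3) by (metis ord_eq_1 nat_dvd_1_iff_1)
qed

text \<open>A conjugate of a commutator is the commutator of the conjugates, and normality keeps the
  conjugate of \<open>h\<close> in \<open>N\<close>; the generating set is thus closed under
  conjugation.\<close>

lemma normal_generate_commutators:
  assumes N: "N \<lhd> G"
  shows "generate G (\<Union>h\<in>N. \<Union>g\<in>carrier G. {h \<otimes> g \<otimes> inv h \<otimes> inv g}) \<lhd> G"
proof -
  interpret N: normal N G by fact
  show ?thesis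
  proof (rule normal_generateI)
    show "(\<Union>h\<in>N. \<Union>g\<in>carrier G. {h \<otimes> g \<otimes> inv h \<otimes> inv g}) \<subseteq> carrier G"
      using N.subset by auto
  next
    fix c a
    assume "c \<in> (\<Union>h\<in>N. \<Union>g\<in>carrier G. {h \<otimes> g \<otimes> inv h \<otimes> inv g})" and a: "a \<in> carrier G"
    then obtain h g where h: "h \<in> N" and g: "g \<in> carrier G" and c: "c = h \<otimes> g \<otimes> inv h \<otimes> inv g"
      by auto
    have hc: "h \<in> carrier G" using h N.subset by auto
    have "a \<otimes> c \<otimes> inv a = (a \<otimes> h \<otimes> inv a) \<otimes> (a \<otimes> g \<otimes> inv a) \<otimes> inv (a \<otimes> h \<otimes> inv a) \<otimes> inv (a \<otimes> g \<otimes> inv a)"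
      using a hc g by (simp add: c inv_mult_group m_assoc mult_inv_cancel)
    moreover have "a \<otimes> h \<otimes> inv a \<in> N" using N.inv_op_closed2 a h by blast
    ultimately show "a \<otimes> c \<otimes> inv a \<in> (\<Union>h\<in>N. \<Union>g\<in>carrier G. {h \<otimes> g \<otimes> inv h \<otimes> inv g})"
      using a g by blast
  qed
qed

lemma normal_lower_central: "lower_central G k \<lhd> G"
proof (induction k)
  case 0
  show ?case by (simp add: normal_invI subgroup_self)
next
  case (Suc k)
  then show ?case using normal_generate_commutators by simp
qed

text \<open>Induction along the series: modulo the next term the commutator becomes central, so by
  \<open>central_commutator_eq_one\<close> it is trivial there, that is, it lies in that next
  term.\<close>

lemma commutator_in_lower_central:
  assumes x: "x \<in> carrier G" and y: "y \<in> carrier G" and cop: "coprime (ord x) (ord y)"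
  shows "x \<otimes> y \<otimes> inv x \<otimes> inv y \<in> lower_central G k"
proof (induction k)
  case 0
  show ?case using x y by simp
next
  case (Suc k)
  define N where "N = lower_central G (Suc k)"
  define z where "z = x \<otimes> y \<otimes> inv x \<otimes> inv y"
  interpret N: normal N G unfolding N_def by (rule normal_lower_central)
  interpret Q: group "G Mod N" by (rule N.factorgroup_is_group)
  define \<pi> where "\<pi> = (\<lambda>a. N #> a)"
  interpret h: group_hom G "G Mod N" \<pi>
    unfolding group_hom_def group_hom_axioms_def \<pi>_def
    using N.r_coset_hom_Mod is_group Q.is_group by blast
  have zc: "z \<in> carrier G" using x y by (simp add: z_def)
  have central: "\<pi> z \<otimes>\<^bsub>G Mod N\<^esub> \<pi> g = \<pi> g \<otimes>\<^bsub>G Mod N\<^esub> \<pi> z" if g: "g \<in> carrier G" for g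
  proof -
    \<comment> \<open>By the induction hypothesis \<open>z\<close> lies in term \<open>k\<close>, so
      its commutator with \<open>g\<close> is one of the generators of \<open>N\<close>.\<close>
    have "z \<otimes> g \<otimes> inv z \<otimes> inv g \<in> N"
      unfolding N_def lower_central.simps using Suc g
      by (intro generate.incl) (auto simp: z_def)
    then have "\<pi> (z \<otimes> g \<otimes> inv z \<otimes> inv g) = \<one>\<^bsub>G Mod N\<^esub>"
      unfolding \<pi>_def by (simp add: coset_join2 N.subgroup_axioms FactGroup_def)
    then have *: "\<pi> (z \<otimes> g \<otimes> inv z \<otimes> inv g \<otimes> (g \<otimes> z)) = \<pi> (g \<otimes> z)"
      using g zc h.hom_mult[of "z \<otimes> g \<otimes> inv z \<otimes> inv g" "g \<otimes> z"] Q.l_one h.hom_closed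
      by (metis inv_closed m_closed)
    have "z \<otimes> g \<otimes> inv z \<otimes> inv g \<otimes> (g \<otimes> z) = z \<otimes> g"
      using g zc by (simp add: m_assoc mult_inv_cancel)
    then show ?thesis using * h.hom_mult g zc by metis
  qed
  have xyz: "x \<otimes> y = z \<otimes> y \<otimes> x"
    using x y by (simp add: z_def m_assoc)
  have "\<pi> z = \<one>\<^bsub>G Mod N\<^esub>"
  proof (rule Q.central_commutator_eq_one)
    show "\<pi> x \<otimes>\<^bsub>G Mod N\<^esub> \<pi> y = \<pi> z \<otimes>\<^bsub>G Mod N\<^esub> \<pi> y \<otimes>\<^bsub>G Mod N\<^esub> \<pi> x"
      using arg_cong[OF xyz, of \<pi>] x y zc by simp
    show "\<pi> x [^]\<^bsub>G Mod N\<^esub> ord x = \<one>\<^bsub>G Mod N\<^esub>" "\<pi> y [^]\<^bsub>G Mod N\<^esub> ord y = \<one>\<^bsub>G Mod N\<^esub>"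
      using x y by (simp_all flip: h.hom_nat_pow)
  qed (use x y zc cop central in auto)
  then have "N #> z = N" by (simp add: \<pi>_def FactGroup_def)
  then show ?case
    using coset_join1 zc N.subgroup_axioms unfolding N_def z_def by blast
qed

lemma nilpotent_coprime_commute:
  assumes "nilpotent_group G"
    and x: "x \<in> carrier G" and y: "y \<in> carrier G" and "coprime (ord x) (ord y)"
  shows "x \<otimes> y = y \<otimes> x"
proof -
  obtain k where "lower_central G k = {\<one>}"
    using assms(1) by (auto simp: nilpotent_group_def)
  then have "x \<otimes> y \<otimes> inv x \<otimes> inv y = \<one>"
    using commutator_in_lower_central[of x y k] assms by auto
  then have "x \<otimes> y \<otimes> inv x \<otimes> inv y \<otimes> (y \<otimes> x) = y \<otimes> x"
    using x y by simp
  then show ?thesis using x y by (simp add: m_assoc mult_inv_cancel)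
qed

section \<open>Products of elements of coprime order\<close>

text \<open>On elements of order dividing \<open>m\<close>, taking \<open>n\<close>-th powers is
  undone by taking \<open>k\<close>-th powers, where \<open>k\<close> inverts \<open>n\<close>
  modulo \<open>m\<close>.\<close>

lemma eq_of_coprime_pow_eq:
  assumes carr: "x \<in> carrier G" "x' \<in> carrier G"
    and m: "ord x dvd m" "ord x' dvd m" and cop: "coprime n m"
    and eq: "x [^] n = x' [^] (n::nat)"
  shows "x = x'"
proof -
  obtain k where "[n * k = 1] (mod m)"
    using cong_solve_coprime_nat[OF cop] by auto
  \<comment> \<open>The congruence in additive form over the naturals; the multiples of
    \<open>m\<close> vanish in exponents.\<close>
  then obtain i j where ij: "1 + i * m = n * k + j * m"
    unfolding cong_iff_lin_nat by blast
  have red: "u [^] (n * k) = u" if u: "u \<in> carrier G" "ord u dvd m" for u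
  proof -
    have 1: "u [^] (l * m) = \<one>" for l :: nat using u by (simp add: pow_eq_id)
    have "u [^] (1 + i * m) = u [^] (n * k + j * m)" using ij by simp
    then show ?thesis using u(1) by (simp add: 1 flip: nat_pow_mult)
  qed
  have "x [^] (n * k) = x' [^] (n * k)"
    using eq carr by (simp flip: nat_pow_pow)
  then show ?thesis using red carr m by simp
qed

text \<open>Raising \<open>x \<otimes> y\<close> to the power
  \<open>ord (x \<otimes> y) * ord y\<close> removes the factor \<open>y\<close>, so
  \<open>ord x\<close> divides this exponent and, by coprimality, \<open>ord (x \<otimes> y)\<close>
  itself. The same holds for \<open>ord y\<close>, and coprime divisors multiply.\<close>

lemma ord_mult_coprime:
  assumes x: "x \<in> carrier G" and y: "y \<in> carrier G"
    and comm: "x \<otimes> y = y \<otimes> x" and cop: "coprime (ord x) (ord y)"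
  shows "ord (x \<otimes> y) = ord x * ord y"
proof (rule dvd_antisym)
  show "ord (x \<otimes> y) dvd ord x * ord y" by (rule ord_mul_divides[OF comm x y])
next
  have pow: "x [^] k \<otimes> y [^] k = (x \<otimes> y) [^] k" for k :: nat
    by (simp add: pow_mult_distrib[OF comm x y])
  let ?d = "ord (x \<otimes> y)"
  have "x [^] (?d * ord y) = \<one>"
  proof -
    have "x [^] (?d * ord y) \<otimes> y [^] (?d * ord y) = \<one>"
      unfolding pow using x y by (simp add: pow_eq_id)
    moreover have "y [^] (?d * ord y) = \<one>" using y by (simp add: pow_eq_id)
    ultimately show ?thesis using x by simp
  qed
  then have 1: "ord x dvd ?d * ord y" using x by (simp add: pow_eq_id)
  have "y [^] (?d * ord x) = \<one>"
  proof -
    have "x [^] (?d * ord x) \<otimes> y [^] (?d * ord x) = \<one>"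
      unfolding pow using x y by (simp add: pow_eq_id)
    moreover have "x [^] (?d * ord x) = \<one>" using x by (simp add: pow_eq_id)
    ultimately show ?thesis using y by simp
  qed
  then have "ord y dvd ?d * ord x" using y by (simp add: pow_eq_id)
  with 1 cop show "ord x * ord y dvd ?d"
    by (metis coprime_commute coprime_dvd_mult_left_iff divides_mult)
qed

text \<open>
  The sets \<open>S\<close> need not be known to be subgroups: once every prime has been used, \<open>S\<close> is the whole
  carrier by cardinality, so neither normality of Sylow subgroups nor direct products are needed.
\<close>
lemma sum_coprime_products:
  fixes f :: "nat \<Rightarrow> real" and a :: "nat \<Rightarrow> nat"
  assumes comm: "\<And>x y. x \<in> carrier G \<Longrightarrow> y \<in> carrier G \<Longrightarrow> coprime (ord x) (ord y) \<Longrightarrow> x \<otimes> y = y \<otimes> x"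
    and f1: "f 1 = 1" and f_mult: "\<And>m n. coprime m n \<Longrightarrow> f (m * n) = f m * f n"
    and "finite A"
    and "\<And>p. p \<in> A \<Longrightarrow> prime p \<and> P p \<subseteq> carrier G \<and> card (P p) = p ^ a p \<and> (\<forall>x\<in>P p. ord x dvd p ^ a p)"
  shows "\<exists>S\<subseteq>carrier G. card S = (\<Prod>p\<in>A. p ^ a p) \<and> (\<forall>x\<in>S. ord x dvd (\<Prod>p\<in>A. p ^ a p))
           \<and> (\<Sum>x\<in>S. f (ord x)) = (\<Prod>p\<in>A. \<Sum>x\<in>P p. f (ord x))"
  using assms(4,5)
proof (induction A rule: finite_induct)
  case empty
  show ?case using f1 by (intro exI[of _ "{\<one>}"]) simp
next
  case (insert q A)
  let ?m = "\<Prod>p\<in>A. p ^ a p"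
  obtain S where S: "S \<subseteq> carrier G" "card S = ?m" "\<And>x. x \<in> S \<Longrightarrow> ord x dvd ?m"
      and sumS: "(\<Sum>x\<in>S. f (ord x)) = (\<Prod>p\<in>A. \<Sum>x\<in>P p. f (ord x))"
    using insert.IH insert.prems by auto
  have q: "prime q" "P q \<subseteq> carrier G" "card (P q) = q ^ a q" "\<And>y. y \<in> P q \<Longrightarrow> ord y dvd q ^ a q"
    using insert.prems by auto
  have cop: "coprime ?m (q ^ a q)"
  proof (rule prod_coprime_left)
    fix p assume "p \<in> A"
    then have "prime p" "p \<noteq> q" using insert by auto
    with q(1) show "coprime (p ^ a p) (q ^ a q)" by (simp add: primes_coprime)
  qed
  have cop_ord: "coprime (ord x) (ord y)" if "x \<in> S" "y \<in> P q" for x y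
    using cop S(3)[OF that(1)] q(4)[OF that(2)] by (meson coprime_divisors)
  have xy: "x \<otimes> y = y \<otimes> x" "ord (x \<otimes> y) = ord x * ord y" if "x \<in> S" "y \<in> P q" for x y
  proof -
    have carr: "x \<in> carrier G" "y \<in> carrier G" using that S(1) q(2) by auto
    show *: "x \<otimes> y = y \<otimes> x" using comm carr cop_ord that by blast
    show "ord (x \<otimes> y) = ord x * ord y" using ord_mult_coprime carr * cop_ord that by blast
  qed
  have inj: "inj_on (\<lambda>(x, y). x \<otimes> y) (S \<times> P q)"
  proof (rule inj_onI, clarify)
    fix x y x' y'
    assume mem: "x \<in> S" "y \<in> P q" "x' \<in> S" "y' \<in> P q" and eq: "x \<otimes> y = x' \<otimes> y'"
    have carr: "x \<in> carrier G" "y \<in> carrier G" "x' \<in> carrier G" "y' \<in> carrier G"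
      using mem S(1) q(2) by auto
    \<comment> \<open>The power \<open>q ^ a q\<close> erases the component in \<open>P q\<close>,
      and it is injective on \<open>S\<close> because it is coprime to the orders there.\<close>
    have pow: "(u \<otimes> v) [^] (q ^ a q) = u [^] (q ^ a q)" if "u \<in> S" "v \<in> P q" for u v
    proof -
      have uv: "u \<in> carrier G" "v \<in> carrier G" using that S(1) q(2) by auto
      moreover have "v [^] (q ^ a q) = \<one>" using uv q(4)[OF that(2)] by (simp add: pow_eq_id)
      ultimately show ?thesis using pow_mult_distrib[OF xy(1)[OF that]] by simp
    qed
    have "x [^] (q ^ a q) = x' [^] (q ^ a q)"
      using pow[OF mem(1,2)] pow[OF mem(3,4)] eq by simp
    then have "x = x'"
      using eq_of_coprime_pow_eq[of x x' ?m "q ^ a q"] carr mem S(3) cop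
      by (simp add: coprime_commute)
    then show "x = x' \<and> y = y'" using eq carr by simp
  qed
  let ?T = "(\<lambda>(x, y). x \<otimes> y) ` (S \<times> P q)"
  have prod: "(\<Prod>p\<in>insert q A. p ^ a p) = ?m * q ^ a q"
    using insert by simp
  show ?case
  proof (intro exI[of _ ?T] conjI ballI)
    show "?T \<subseteq> carrier G" using S(1) q(2) by auto
    show "card ?T = (\<Prod>p\<in>insert q A. p ^ a p)"
      unfolding prod card_image[OF inj] card_cartesian_product S(2) q(3) ..
  next
    fix t assume "t \<in> ?T"
    then show "ord t dvd (\<Prod>p\<in>insert q A. p ^ a p)"
      unfolding prod using xy(2) S(3) q(4) by (auto intro!: mult_dvd_mono)
  next
    have "(\<Sum>t\<in>?T. f (ord t)) = (\<Sum>(x, y)\<in>S \<times> P q. f (ord (x \<otimes> y)))"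
      by (subst sum.reindex[OF inj]) (simp add: case_prod_unfold)
    also have "\<dots> = (\<Sum>(x, y)\<in>S \<times> P q. f (ord x) * f (ord y))"
      by (rule sum.cong) (auto simp: xy(2) f_mult cop_ord)
    also have "\<dots> = (\<Sum>x\<in>S. f (ord x)) * (\<Sum>y\<in>P q. f (ord y))"
      by (simp add: sum_product sum.cartesian_product)
    finally show "(\<Sum>t\<in>?T. f (ord t)) = (\<Prod>p\<in>insert q A. \<Sum>x\<in>P p. f (ord x))"
      using insert sumS by (simp add: mult.commute)
  qed
qed

text \<open>Supplies the contradiction with non-cyclicity: elements of full prime power order, one
  for each prime, are multiplied together, and their orders multiply.\<close>

lemma ex_ord_prod:
  fixes a :: "nat \<Rightarrow> nat"
  assumes comm: "\<And>x y. x \<in> carrier G \<Longrightarrow> y \<in> carrier G \<Longrightarrow> coprime (ord x) (ord y) \<Longrightarrow> x \<otimes> y = y \<otimes> x"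
    and "finite A"
    and "\<And>p. p \<in> A \<Longrightarrow> prime p \<and> (\<exists>x\<in>carrier G. ord x = p ^ a p)"
  shows "\<exists>x\<in>carrier G. ord x = (\<Prod>p\<in>A. p ^ a p)"
  using assms(2,3)
proof (induction A rule: finite_induct)
  case empty
  show ?case by (intro bexI[of _ \<one>]) simp_all
next
  case (insert q A)
  obtain x where x: "x \<in> carrier G" "ord x = (\<Prod>p\<in>A. p ^ a p)"
    using insert by auto
  obtain y where y: "prime q" "y \<in> carrier G" "ord y = q ^ a q"
    using insert by auto
  have "coprime (ord x) (ord y)"
    unfolding x y
  proof (rule prod_coprime_left)
    fix p assume "p \<in> A"
    then have "prime p" "p \<noteq> q" using insert by auto
    with y(1) show "coprime (p ^ a p) (q ^ a q)" by (simp add: primes_coprime)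
  qed
  then have "ord (x \<otimes> y) = ord x * ord y"
    using ord_mult_coprime comm x y by blast
  then have "ord (x \<otimes> y) = (\<Prod>p\<in>insert q A. p ^ a p)"
    using x y insert.hyps by (simp add: mult.commute)
  then show ?case using x y by (intro bexI[of _ "x \<otimes> y"]) auto
qed

section \<open>Cyclicity, and element orders in subgroups of prime power order\<close>

lemma cyclic_group_if_ord_eq_order:
  assumes fin: "finite (carrier G)" and x: "x \<in> carrier G" and "ord x = order G"
  shows "cyclic_group G"
proof -
  have "generate G {x} = carrier G"
    using generate_pow_card[OF x] assms fin
    by (intro card_subset_eq generate_incl) (auto simp: order_def)
  then have "subgroup_generated G {x} = G"
    using x by (simp add: subgroup_generated_def)
  then show ?thesis using x unfolding cyclic_group_def by blast
qed

text \<open>Lagrange's theorem for \<open>H\<close> taken as a group of its own, whose powers agree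
  with those of \<open>G\<close>.\<close>

lemma ord_dvd_card_subgroup:
  assumes H: "subgroup H G" and x: "x \<in> H"
  shows "ord x dvd card H"
proof -
  interpret H: group "G\<lparr>carrier := H\<rparr>" by (rule subgroup_imp_group[OF H])
  have "x [^]\<^bsub>G\<lparr>carrier := H\<rparr>\<^esub> order (G\<lparr>carrier := H\<rparr>) = \<one>\<^bsub>G\<lparr>carrier := H\<rparr>\<^esub>"
    using x by (intro H.pow_order_eq_1) simp
  then have "x [^] card H = \<one>"
    by (simp add: order_def flip: nat_pow_consistent)
  then show ?thesis using subgroup.mem_carrier[OF H x] by (simp add: pow_eq_id)
qed

text \<open>Sylow's theorem inside \<open>P\<close> gives a subgroup of order \<open>p ^ k\<close>,
  and by Lagrange all its elements are counted on the right.\<close>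

lemma card_ord_dvd_prime_power_ge:
  assumes P: "subgroup P G" and fin: "finite P" and p: "prime p"
    and card: "card P = p ^ a" and k: "k \<le> a"
  shows "p ^ k \<le> card {x \<in> P. ord x dvd p ^ k}"
proof -
  interpret P: group "G\<lparr>carrier := P\<rparr>" by (rule subgroup_imp_group[OF P])
  \<comment> \<open>Sylow's theorem is applied to the factor \<open>p ^ k\<close>; the cofactor may
    still be divisible by \<open>p\<close>.\<close>
  have "order (G\<lparr>carrier := P\<rparr>) = p ^ k * p ^ (a - k)"
    using k by (simp add: order_def card flip: power_add)
  then obtain H where H: "subgroup H (G\<lparr>carrier := P\<rparr>)" "card H = p ^ k"
    using sylow_thm[OF p P.is_group] fin by auto
  have "subgroup H G" using incl_subgroup[OF P H(1)] .
  then have "H \<subseteq> {x \<in> P. ord x dvd p ^ k}"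
    using ord_dvd_card_subgroup H subgroup.subset[OF H(1)] by force
  then show ?thesis using card_mono[of "{x \<in> P. ord x dvd p ^ k}" H] fin H(2) by simp
qed

lemma card_ord_dvd_1:
  assumes "subgroup H G"
  shows "card {x \<in> H. ord x dvd 1} = 1"
proof -
  have "{x \<in> H. ord x dvd 1} = {\<one>}"
    using subgroup.one_closed[OF assms] subgroup.mem_carrier[OF assms]
    by (auto simp flip: One_nat_def simp: ord_eq_1[symmetric])
  then show ?thesis by simp
qed

end

section \<open>Comparing sums over sets of prime power orders\<close>

text \<open>With \<open>n = d * e\<close>, a residue killed by \<open>d\<close> is a multiple of
  \<open>e\<close>, and exactly \<open>d\<close> such multiples lie between 0 and
  \<open>n - 1\<close>.\<close>

lemma card_ord_dvd_integer_mod_group_le: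
  assumes n: "n > 0" and d: "d dvd n"
  shows "card {x \<in> carrier (integer_mod_group n). group.ord (integer_mod_group n) x dvd d} \<le> d"
proof -
  interpret group "integer_mod_group n" by simp
  obtain e where e: "n = d * e" using d by (auto simp: dvd_def)
  have "{x \<in> carrier (integer_mod_group n). ord x dvd d} \<subseteq> (\<lambda>j. int e * int j) ` {..<d}"
  proof
    fix x assume x: "x \<in> {x \<in> carrier (integer_mod_group n). ord x dvd d}"
    then have "x [^]\<^bsub>integer_mod_group n\<^esub> d = \<one>\<^bsub>integer_mod_group n\<^esub>"
      by (simp only: mem_Collect_eq pow_eq_id)
    then have "(int d * x) mod int n = 0"
      by simp
    then have "int e dvd x" using n e by auto
    then obtain j where j: "x = int e * j" by blast
    have bounds: "0 \<le> x" "x < int n" using x n by (auto simp: carrier_integer_mod_group)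
    have "e > 0" using n e by auto
    then have "0 \<le> j" "j < int d"
      using bounds unfolding j e by (auto simp: zero_le_mult_iff mult.commute)
    then show "x \<in> (\<lambda>j. int e * int j) ` {..<d}"
      using j by (intro image_eqI[of _ _ "nat j"]) auto
  qed
  then show ?thesis
    by (metis (no_types, lifting) card_image_le card_lessThan card_mono finite_imageI finite_lessThan le_trans)
qed

text \<open>Summation by parts: the value at \<open>p ^ i\<close> is the value at
  \<open>p ^ a\<close> plus a telescoping sum over \<open>i \<le> k < a\<close>; exchanging the sums
  collects the elements with \<open>d x dvd p ^ k\<close>. Thus \<open>S\<close> enters only through
  counts.\<close>

lemma sum_prime_power_orders:
  fixes h :: "nat \<Rightarrow> real"
  assumes p: "prime p" and fin: "finite S" and dvd: "\<And>x. x \<in> S \<Longrightarrow> d x dvd p ^ a"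
  shows "(\<Sum>x\<in>S. h (d x)) = card S * h (p ^ a)
           + (\<Sum>k<a. card {x \<in> S. d x dvd p ^ k} * (h (p ^ k) - h (p ^ Suc k)))"
proof -
  have 1: "h (d x) = h (p ^ a) + (\<Sum>k<a. if d x dvd p ^ k then h (p ^ k) - h (p ^ Suc k) else 0)"
    if x: "x \<in> S" for x
  proof -
    obtain i where i: "i \<le> a" "d x = p ^ i"
      using dvd[OF x] p by (auto simp: divides_primepow_nat)
    have "p ^ i dvd p ^ k \<longleftrightarrow> i \<le> k" for k
      using prime_gt_1_nat[OF p] by (simp add: dvd_power_iff_le)
    then have "(\<Sum>k<a. if d x dvd p ^ k then h (p ^ k) - h (p ^ Suc k) else 0)
        = (\<Sum>k<a. if i \<le> k then h (p ^ k) - h (p ^ Suc k) else 0)"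
      by (simp add: i)
    also have "\<dots> = (\<Sum>k=i..<a. h (p ^ k) - h (p ^ Suc k))"
      by (rule sum.mono_neutral_cong_right) auto
    \<comment> \<open>The telescoping rule yields upper minus lower value, hence its use for the
      negative of \<open>h\<close>.\<close>
    also have "\<dots> = h (p ^ i) - h (p ^ a)"
      using sum_Suc_diff'[OF i(1), of "\<lambda>k. - h (p ^ k)"] by simp
    finally show ?thesis by (simp add: i)
  qed
  have "(\<Sum>x\<in>S. h (d x)) = (\<Sum>x\<in>S. h (p ^ a))
      + (\<Sum>x\<in>S. \<Sum>k<a. if d x dvd p ^ k then h (p ^ k) - h (p ^ Suc k) else 0)"
    by (simp add: 1 sum.distrib)
  also have "(\<Sum>x\<in>S. \<Sum>k<a. if d x dvd p ^ k then h (p ^ k) - h (p ^ Suc k) else 0)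
      = (\<Sum>k<a. \<Sum>x\<in>S. if d x dvd p ^ k then h (p ^ k) - h (p ^ Suc k) else 0)"
    by (rule sum.swap)
  also have "\<dots> = (\<Sum>k<a. card {x \<in> S. d x dvd p ^ k} * (h (p ^ k) - h (p ^ Suc k)))"
    using fin by (simp flip: sum.inter_filter)
  finally show ?thesis by simp
qed

text \<open>\<open>S\<close> models a Sylow subgroup of the given group and \<open>T\<close> its
  counterpart in the cyclic group, with \<open>d\<close> and \<open>d'\<close> as orders. Abstract
  order functions allow for different element types.\<close>

context
  fixes p a :: nat and S :: "'a set" and T :: "'b set" and d :: "'a \<Rightarrow> nat" and d' :: "'b \<Rightarrow> nat"
  assumes p: "prime p" and fin: "finite S" "finite T"
    and card: "card S = p ^ a" "card T = p ^ a"
    and dvd: "\<And>x. x \<in> S \<Longrightarrow> d x dvd p ^ a" "\<And>y. y \<in> T \<Longrightarrow> d' y dvd p ^ a"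
    and card_1: "card {x \<in> S. d x dvd 1} = 1" "card {y \<in> T. d' y dvd 1} = 1"
    and ge: "\<And>k. k \<le> a \<Longrightarrow> p ^ k \<le> card {x \<in> S. d x dvd p ^ k}"
    and le: "\<And>k. k \<le> a \<Longrightarrow> card {y \<in> T. d' y dvd p ^ k} \<le> p ^ k"
begin

text \<open>Compares the two summations by parts term by term: for \<open>k \<ge> 1\<close> the
  weight is nonnegative and \<open>p ^ k\<close> separates the two counts.\<close>

lemma weighted_card_le:
  fixes h :: "nat \<Rightarrow> real"
  assumes h: "\<And>k. k \<ge> 1 \<Longrightarrow> h (p ^ Suc k) \<le> h (p ^ k)" and k: "k < a"
  shows "card {y \<in> T. d' y dvd p ^ k} * (h (p ^ k) - h (p ^ Suc k))
       \<le> card {x \<in> S. d x dvd p ^ k} * (h (p ^ k) - h (p ^ Suc k))"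
proof (cases "k = 0")
  case True
  \<comment> \<open>nothing is assumed about \<open>h 1\<close> versus \<open>h p\<close>, but here the two counts agree\<close>
  then show ?thesis using card_1 by simp
next
  case False
  have "card {y \<in> T. d' y dvd p ^ k} \<le> card {x \<in> S. d x dvd p ^ k}"
    using ge[of k] le[of k] k by simp
  then show ?thesis using h[of k] False by (intro mult_right_mono) auto
qed

text \<open>The leading terms agree, since both sets have \<open>p ^ a\<close> elements; the rest is
  \<open>weighted_card_le\<close>.\<close>

lemma sum_prime_power_orders_le:
  fixes h :: "nat \<Rightarrow> real"
  assumes h: "\<And>k. k \<ge> 1 \<Longrightarrow> h (p ^ Suc k) \<le> h (p ^ k)"
  shows "(\<Sum>y\<in>T. h (d' y)) \<le> (\<Sum>x\<in>S. h (d x))"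
proof -
  have "(\<Sum>k<a. card {y \<in> T. d' y dvd p ^ k} * (h (p ^ k) - h (p ^ Suc k)))
      \<le> (\<Sum>k<a. card {x \<in> S. d x dvd p ^ k} * (h (p ^ k) - h (p ^ Suc k)))"
  proof (rule sum_mono)
    fix k assume "k \<in> {..<a}"
    then show "card {y \<in> T. d' y dvd p ^ k} * (h (p ^ k) - h (p ^ Suc k))
        \<le> card {x \<in> S. d x dvd p ^ k} * (h (p ^ k) - h (p ^ Suc k))"
      using weighted_card_le h by simp
  qed
  then show ?thesis
    using sum_prime_power_orders[where d = d and h = h, OF p fin(1) dvd(1)]
      sum_prime_power_orders[where d = d' and h = h, OF p fin(2) dvd(2)]
    by (simp add: card)
qed

text \<open>The last index \<open>k = a - 1\<close> is strict: without elements of full order all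
  \<open>p ^ a\<close> elements of \<open>S\<close> are counted there, against at most
  \<open>p ^ (a - 1)\<close> in \<open>T\<close>.\<close>

lemma sum_prime_power_orders_less:
  fixes h :: "nat \<Rightarrow> real"
  assumes h: "\<And>k. k \<ge> 1 \<Longrightarrow> h (p ^ Suc k) < h (p ^ k)"
    and noncyclic: "\<And>x. x \<in> S \<Longrightarrow> d x \<noteq> p ^ a"
  shows "(\<Sum>y\<in>T. h (d' y)) < (\<Sum>x\<in>S. h (d x))"
proof -
  have p1: "p > 1" by (rule prime_gt_1_nat[OF p])
  have "S \<noteq> {}" using card(1) p1 by auto
  \<comment> \<open>For \<open>a = 0\<close> every element would have full order
    \<open>p ^ 0 = 1\<close>.\<close>
  have "a \<noteq> 0"
    using \<open>S \<noteq> {}\<close> noncyclic dvd(1) by fastforce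
  then obtain b where b: "a = Suc b" using not0_implies_Suc by blast
  have all: "{x \<in> S. d x dvd p ^ b} = S"
  proof -
    have "d x dvd p ^ b" if x: "x \<in> S" for x
    proof -
      obtain i where i: "i \<le> a" "d x = p ^ i"
        using dvd(1)[OF x] p by (auto simp: divides_primepow_nat)
      then have "i \<le> b" using noncyclic[OF x] b by (cases "i = a") auto
      then show ?thesis using i by (simp add: le_imp_power_dvd)
    qed
    then show ?thesis by blast
  qed
  \<comment> \<open>The strict decrease of \<open>h\<close> starts only at index 1. If
    \<open>b\<close> were 0, then \<open>S\<close> would be a single element although it has
    \<open>p\<close> of them.\<close>
  have b0: "b \<noteq> 0"
  proof
    assume "b = 0"
    then have "card S = 1" using all card_1(1) by simp
    then show False using card(1) b p1 by simp
  qed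
  have "(\<Sum>k<a. card {y \<in> T. d' y dvd p ^ k} * (h (p ^ k) - h (p ^ Suc k)))
      < (\<Sum>k<a. card {x \<in> S. d x dvd p ^ k} * (h (p ^ k) - h (p ^ Suc k)))"
  proof (rule sum_strict_mono_ex1)
    show "\<forall>k\<in>{..<a}. card {y \<in> T. d' y dvd p ^ k} * (h (p ^ k) - h (p ^ Suc k))
        \<le> card {x \<in> S. d x dvd p ^ k} * (h (p ^ k) - h (p ^ Suc k))"
      using weighted_card_le h by (simp add: less_imp_le)
    have "card {y \<in> T. d' y dvd p ^ b} < card {x \<in> S. d x dvd p ^ b}"
    proof -
      have "card {y \<in> T. d' y dvd p ^ b} \<le> p ^ b" using le[of b] b by simp
      also have "\<dots> < p ^ a" using b p1 by simp
      finally show ?thesis by (simp add: all card)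
    qed
    then have "card {y \<in> T. d' y dvd p ^ b} * (h (p ^ b) - h (p ^ Suc b))
        < card {x \<in> S. d x dvd p ^ b} * (h (p ^ b) - h (p ^ Suc b))"
      using h[of b] b0 by (intro mult_strict_right_mono) auto
    then show "\<exists>k\<in>{..<a}. card {y \<in> T. d' y dvd p ^ k} * (h (p ^ k) - h (p ^ Suc k))
        < card {x \<in> S. d x dvd p ^ k} * (h (p ^ k) - h (p ^ Suc k))"
      using b by blast
  qed simp
  then show ?thesis
    using sum_prime_power_orders[where d = d and h = h, OF p fin(1) dvd(1)]
      sum_prime_power_orders[where d = d' and h = h, OF p fin(2) dvd(2)]
    by (simp add: card)
qed

end

section \<open>The summand\<close>

text \<open>The term of \<open>R_fun\<close> as an arithmetic function of the order, so that its
  multiplicativity can be stated.\<close>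

definition summand :: "real \<Rightarrow> real \<Rightarrow> nat \<Rightarrow> real" where
  "summand r s d = real d powr s / real (totient d) powr r"

lemma summand_1: "summand r s 1 = 1"
  by (simp add: summand_def)

lemma summand_mult:
  assumes "coprime m n"
  shows "summand r s (m * n) = summand r s m * summand r s n"
  using assms by (simp add: summand_def totient_mult_coprime powr_mult)

lemma summand_pos: "d > 0 \<Longrightarrow> summand r s d > 0"
  by (simp add: summand_def)

text \<open>For \<open>k \<ge> 1\<close> both the number and its totient gain a factor
  \<open>p\<close>; from 1 to \<open>p\<close> the totient gains \<open>p - 1\<close> instead, so
  that step obeys a different law.\<close>

lemma summand_prime_power_Suc:
  assumes p: "prime p" and k: "k \<ge> 1"
  shows "summand r s (p ^ Suc k) = real p powr (s - r) * summand r s (p ^ k)"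
proof -
  obtain j where j: "k = Suc j" using k by (cases k) auto
  have "totient (p ^ Suc k) = p * totient (p ^ k)"
    unfolding j totient_prime_power_Suc[OF p] by simp
  then have "summand r s (p ^ Suc k)
      = (real p * real (p ^ k)) powr s / (real p * real (totient (p ^ k))) powr r"
    by (simp only: summand_def power_Suc of_nat_mult)
  also have "\<dots> = (real p powr s / real p powr r) * summand r s (p ^ k)"
    by (simp add: summand_def powr_mult)
  finally show ?thesis by (simp add: powr_diff)
qed

text \<open>The ratio of consecutive values, \<open>real p powr (s - r)\<close>, is below, equal to
  or above 1 according to the sign of \<open>s - r\<close>.\<close>

lemma summand_prime_power_mono:
  assumes p: "prime p" and k: "k \<ge> 1"
  shows "s < r \<Longrightarrow> summand r s (p ^ Suc k) < summand r s (p ^ k)"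
    and "s = r \<Longrightarrow> summand r s (p ^ Suc k) = summand r s (p ^ k)"
    and "s > r \<Longrightarrow> summand r s (p ^ Suc k) > summand r s (p ^ k)"
proof -
  have p1: "real p > 1" using prime_gt_1_nat[OF p] by simp
  have pos: "summand r s (p ^ k) > 0" using p1 by (intro summand_pos) simp
  show "s < r \<Longrightarrow> summand r s (p ^ Suc k) < summand r s (p ^ k)"
    unfolding summand_prime_power_Suc[OF assms] using p1 pos
    using powr_less_mono[of "s - r" 0 "real p"] by simp
  show "s = r \<Longrightarrow> summand r s (p ^ Suc k) = summand r s (p ^ k)"
    unfolding summand_prime_power_Suc[OF assms] using p1 by simp
  show "s > r \<Longrightarrow> summand r s (p ^ Suc k) > summand r s (p ^ k)"
    unfolding summand_prime_power_Suc[OF assms] using p1 pos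
    using powr_less_mono[of 0 "s - r" "real p"] by simp
qed

section \<open>Factorization over Sylow subgroups and comparison with the cyclic group\<close>

text \<open>Using all primes that divide the order, \<open>sum_coprime_products\<close> yields a set
  as large as the group, hence the whole carrier. Commutation is a hypothesis so that the nilpotent
  group and the cyclic one are both covered.\<close>

lemma R_fun_eq_prod_sylow:
  fixes G (structure)
  assumes G: "group G" and fin: "finite (carrier G)"
    and comm: "\<And>x y. x \<in> carrier G \<Longrightarrow> y \<in> carrier G \<Longrightarrow> coprime (group.ord G x) (group.ord G y)
                 \<Longrightarrow> x \<otimes> y = y \<otimes> x"
    and P: "\<And>p. p \<in> prime_factors (order G) \<Longrightarrow>
              subgroup (P p) G \<and> card (P p) = p ^ multiplicity p (order G)"
  shows "R_fun G r s = (\<Prod>p\<in>prime_factors (order G). \<Sum>x\<in>P p. summand r s (group.ord G x))"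
proof -
  interpret group G by fact
  have n: "order G > 0" using fin by (simp add: order_gt_0_iff_finite)
  have prod: "(\<Prod>p\<in>prime_factors (order G). p ^ multiplicity p (order G)) = order G"
    using prime_factorization_nat[of "order G"] n by simp
  obtain S where S: "S \<subseteq> carrier G" "card S = order G"
    and sum: "(\<Sum>x\<in>S. summand r s (ord x)) = (\<Prod>p\<in>prime_factors (order G). \<Sum>x\<in>P p. summand r s (ord x))"
    using sum_coprime_products[of "summand r s" "prime_factors (order G)" P "\<lambda>p. multiplicity p (order G)"]
      comm summand_1 summand_mult P ord_dvd_card_subgroup subgroup.subset
    unfolding prod by (smt (verit, ccfv_SIG) finite_set_mset in_prime_factors_imp_prime)
  have "S = carrier G" using card_subset_eq[OF fin S(1)] S(2) by (simp add: order_def)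
  then show ?thesis using sum by (simp add: R_fun_def summand_def)
qed

theorem mainTheorem7:
  fixes G :: "('a, 'b) monoid_scheme" and r s :: real
  assumes "group G" and "finite (carrier G)" and "nilpotent_group G"
    and "\<not> cyclic_group G"
  shows "(r > s \<longrightarrow> T_fun G r s > 0) \<and> (r = s \<longrightarrow> T_fun G r s = 0) \<and> (r < s \<longrightarrow> T_fun G r s < 0)"
proof -
  interpret group G by fact
  define n where "n = order G"
  define Z where "Z = integer_mod_group n"
  define A where "A = prime_factors n"
  define a where "a = (\<lambda>p. multiplicity p n)"
  interpret Z: comm_group Z by (simp add: Z_def)
  note fin = \<open>finite (carrier G)\<close>
  have n: "n > 0" using fin by (simp add: n_def order_gt_0_iff_finite)
  have finZ: "finite (carrier Z)" and orderZ: "order Z = n"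
    using n by (simp_all add: Z_def order_def carrier_integer_mod_group)
  have prod: "(\<Prod>p\<in>A. p ^ a p) = n"
    using prime_factorization_nat[OF n] by (simp add: A_def a_def)
  have prime: "prime p" if "p \<in> A" for p using that by (auto simp: A_def)
  have split: "n = p ^ a p * (n div p ^ a p)" for p by (simp add: a_def multiplicity_dvd)
  have "\<exists>H. subgroup H G \<and> card H = p ^ a p" if "p \<in> A" for p
    using sylow_thm[OF prime[OF that] is_group _ fin] split n_def by metis
  then obtain P where P: "\<And>p. p \<in> A \<Longrightarrow> subgroup (P p) G \<and> card (P p) = p ^ a p"
    by metis
  have "\<exists>H. subgroup H Z \<and> card H = p ^ a p" if "p \<in> A" for p
    using sylow_thm[OF prime[OF that] Z.is_group _ finZ] split orderZ by metis
  then obtain Q where Q: "\<And>p. p \<in> A \<Longrightarrow> subgroup (Q p) Z \<and> card (Q p) = p ^ a p"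
    by metis
  define u where "u = (\<lambda>p. \<Sum>x\<in>P p. summand r s (ord x))"
  define v where "v = (\<lambda>p. \<Sum>x\<in>Q p. summand r s (Z.ord x))"
  note comm = nilpotent_coprime_commute[OF \<open>nilpotent_group G\<close>]
  have RG: "R_fun G r s = prod u A"
    unfolding u_def A_def n_def
    by (rule R_fun_eq_prod_sylow) (use is_group fin comm P in \<open>auto simp: A_def a_def n_def\<close>)
  have RZ: "R_fun Z r s = prod v A"
    unfolding v_def A_def orderZ[symmetric]
    by (rule R_fun_eq_prod_sylow)
      (use Z.is_group finZ Z.m_comm Q in \<open>auto simp: A_def a_def orderZ\<close>)
  have T: "T_fun G r s = prod u A - prod v A"
    using RG RZ by (simp add: T_fun_def Z_def n_def)

  have facts: "prime p" "finite (P p)" "finite (Q p)" "card (P p) = p ^ a p" "card (Q p) = p ^ a p"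
    "\<And>x. x \<in> P p \<Longrightarrow> ord x dvd p ^ a p" "\<And>y. y \<in> Q p \<Longrightarrow> Z.ord y dvd p ^ a p"
    "card {x \<in> P p. ord x dvd 1} = 1" "card {y \<in> Q p. Z.ord y dvd 1} = 1"
    "\<And>k. k \<le> a p \<Longrightarrow> p ^ k \<le> card {x \<in> P p. ord x dvd p ^ k}"
    "\<And>k. k \<le> a p \<Longrightarrow> card {y \<in> Q p. Z.ord y dvd p ^ k} \<le> p ^ k"
    if p: "p \<in> A" for p
  proof -
    note Pp = P[OF p] and Qp = Q[OF p]
    show "prime p" by (rule prime[OF p])
    show fP: "finite (P p)" and fQ: "finite (Q p)"
      using Pp Qp fin finZ subgroup.subset finite_subset by metis+
    show "card (P p) = p ^ a p" "card (Q p) = p ^ a p" using Pp Qp by auto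
    show "\<And>x. x \<in> P p \<Longrightarrow> ord x dvd p ^ a p" using ord_dvd_card_subgroup Pp by metis
    show "\<And>y. y \<in> Q p \<Longrightarrow> Z.ord y dvd p ^ a p" using Z.ord_dvd_card_subgroup Qp by metis
    show "card {x \<in> P p. ord x dvd 1} = 1" using Pp card_ord_dvd_1 by blast
    show "card {y \<in> Q p. Z.ord y dvd 1} = 1" using Qp Z.card_ord_dvd_1 by blast
    show "p ^ k \<le> card {x \<in> P p. ord x dvd p ^ k}" if "k \<le> a p" for k
      using card_ord_dvd_prime_power_ge[of "P p" p "a p" k] Pp fP prime[OF p] that by blast
    show "card {y \<in> Q p. Z.ord y dvd p ^ k} \<le> p ^ k" if "k \<le> a p" for k
    proof -
      \<comment> \<open>The count in all of \<open>Z\<close> bounds the count in its subgroup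
        \<open>Q p\<close>.\<close>
      have "p ^ k dvd n" using that by (simp add: a_def multiplicity_dvd')
      then have "card {y \<in> carrier Z. Z.ord y dvd p ^ k} \<le> p ^ k"
        unfolding Z_def using card_ord_dvd_integer_mod_group_le n by blast
      moreover have "card {y \<in> Q p. Z.ord y dvd p ^ k} \<le> card {y \<in> carrier Z. Z.ord y dvd p ^ k}"
        using finZ Qp subgroup.subset by (intro card_mono) fastforce+
      ultimately show ?thesis by simp
    qed
  qed

  \<comment> \<open>This prime \<open>q\<close> is where the comparison becomes strict; without it
    \<open>ex_ord_prod\<close> would give an element of order \<open>n\<close>.\<close>
  have "\<exists>q\<in>A. \<forall>x\<in>P q. ord x \<noteq> q ^ a q"
  proof (rule ccontr)
    assume "\<not> ?thesis"
    then have "prime p \<and> (\<exists>x\<in>carrier G. ord x = p ^ a p)" if "p \<in> A" for p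
      using that prime P subgroup.mem_carrier by metis
    then have "\<exists>x\<in>carrier G. ord x = n"
      using ex_ord_prod[of A a, OF comm] prod by (simp add: A_def)
    then show False
      using cyclic_group_if_ord_eq_order fin \<open>\<not> cyclic_group G\<close> n_def by blast
  qed
  then obtain q where q: "q \<in> A" and noncyclic: "\<And>x. x \<in> P q \<Longrightarrow> ord x \<noteq> q ^ a q"
    by blast
  \<comment> \<open>Positivity of all factors lets a strict inequality at \<open>q\<close> pass to
    the products over \<open>A\<close>.\<close>
  have pos: "u p > 0" "v p > 0" if p: "p \<in> A" for p
  proof -
    have "P p \<noteq> {}" "Q p \<noteq> {}"
      using P[OF p] Q[OF p] subgroup.one_closed by auto
    moreover have "ord x > 0" if "x \<in> P p" for x
      using dvd_pos_nat[OF _ facts(6)[OF p that]] prime_gt_0_nat[OF prime[OF p]] by simp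
    moreover have "Z.ord x > 0" if "x \<in> Q p" for x
      using dvd_pos_nat[OF _ facts(7)[OF p that]] prime_gt_0_nat[OF prime[OF p]] by simp
    ultimately show "u p > 0" "v p > 0"
      unfolding u_def v_def using facts(2,3)[OF p] by (auto intro!: sum_pos summand_pos)
  qed
  have finA: "finite A" by (simp add: A_def)
  have le: "v p \<le> u p" if p: "p \<in> A" and "s \<le> r" for p
  proof -
    have h: "summand r s (p ^ Suc k) \<le> summand r s (p ^ k)" if "k \<ge> 1" for k
      using summand_prime_power_mono(1,2)[OF prime[OF p] that, where r = r and s = s] \<open>s \<le> r\<close> by linarith
    show ?thesis
      unfolding u_def v_def by (rule sum_prime_power_orders_le[where d = ord and d' = Z.ord and h = "summand r s",
        OF facts[OF p]]) (assumption | fact h)+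
  qed
  have ge: "u p \<le> v p" if p: "p \<in> A" and "r \<le> s" for p
  proof -
    \<comment> \<open>For \<open>r \<le> s\<close> the summand does not decrease along powers of
      \<open>p\<close> from index 1 on, so the comparison is applied to its negative and
      reverses.\<close>
    have h: "- summand r s (p ^ Suc k) \<le> - summand r s (p ^ k)" if "k \<ge> 1" for k
      using summand_prime_power_mono(2,3)[OF prime[OF p] that, where r = r and s = s] \<open>r \<le> s\<close> by linarith
    have "(\<Sum>x\<in>Q p. - summand r s (Z.ord x)) \<le> (\<Sum>x\<in>P p. - summand r s (ord x))"
      by (rule sum_prime_power_orders_le[where d = ord and d' = Z.ord and h = "\<lambda>m. - summand r s m",
        OF facts[OF p]]) (assumption | fact h)+
    then show ?thesis by (simp add: u_def v_def sum_negf)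
  qed
  have less: "v q < u q" if "s < r"
    unfolding u_def v_def
    by (rule sum_prime_power_orders_less[where d = ord and d' = Z.ord and h = "summand r s",
        OF facts[OF q]])
      (assumption | fact noncyclic summand_prime_power_mono(1)[OF prime[OF q] _ that])+
  have greater: "u q < v q" if "r < s"
  proof -
    have h: "- summand r s (q ^ Suc k) < - summand r s (q ^ k)" if "k \<ge> 1" for k
      using summand_prime_power_mono(3)[OF prime[OF q] that \<open>r < s\<close>] by linarith
    have "(\<Sum>x\<in>Q q. - summand r s (Z.ord x)) < (\<Sum>x\<in>P q. - summand r s (ord x))"
      by (rule sum_prime_power_orders_less[where d = ord and d' = Z.ord and h = "\<lambda>m. - summand r s m",
        OF facts[OF q]]) (assumption | fact noncyclic h)+
    then show ?thesis by (simp add: u_def v_def sum_negf)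
  qed
  show ?thesis
  proof (intro conjI impI)
    assume "r > s"
    then have "prod v A < prod u A"
      using q finA less le pos by (intro prod_mono_strict) (auto simp: less_imp_le)
    then show "T_fun G r s > 0" by (simp add: T)
  next
    assume "r = s"
    \<comment> \<open>Both weak inequalities hold here, so the factors agree prime by prime.\<close>
    then have "prod u A = prod v A"
      using le ge by (intro prod.cong) (auto intro: antisym)
    then show "T_fun G r s = 0" by (simp add: T)
  next
    assume "r < s"
    then have "prod u A < prod v A"
      using q finA greater ge pos by (intro prod_mono_strict) (auto simp: less_imp_le)
    then show "T_fun G r s < 0" by (simp add: T)
  qed
qed

end
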